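(* Every right generalized inverse semigroup is isomorphic to a right Yamada semigroup. That is, for every right generalized inverse semigroup $S$ there exist an inverse semigroup $T$ and a presheaf of sets with global support $p\colon X\to E(T)$ such that $S$ is isomorphic, as a semigroup, to the right Yamada semigroup $T\ast X$.
   Context: A semigroup $S$ is regular if every $s\in S$ has an inverse $t$, meaning $s=sts$ and $t=tst$. A right normal band is a semigroup of idempotents satisfying the identity $efg=feg$. A right generalized inverse semigroup is a regular semigroup whose set of idempotents is a right normal band (in particular a subsemigroup). For an inverse semigroup $T$, $E(T)$ denotes its meet semilattice of idempotents, and for $t\in T$ we put $\mathbf{d}(t)=t^{-1}t$ and $\mathbf{r}(t)=tt^{-1}$. A presheaf of sets over a meet semilattice $E$ consists of pairwise disjoint sets $X_e$ ($e\in E$) and, for all $e\ge f$ in $E$, restriction functions $X_e\to X_f$, $x\mapsto x|^e_f$, such that $|^e_e$ is the identity and $(x|^e_f)|^f_g=x|^e_g$ whenever $e\ge f\ge g$. Put $X=\bigcup_{e}X_e$ and define $p\colon X\to E$ by $p(x)=e$ if $x\in X_e$. The presheaf has global support if every $X_e$ is non-empty. For $e\in E$ and $x\in X$ write $e\cdot x=x|^{p(x)}_{e\wedge p(x)}$. Given an inverse semigroup $T$ and a presheaf of sets $p\colon X\to E(T)$ with global support, the right Yamada semigroup is the set $T\ast X=\{(t,x)\in T\times X:\mathbf{d}(t)=p(x)\}$ with multiplication $(s,x)(t,y)=(st,\mathbf{d}(st)\cdot y)$. *)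

theory Defs
  imports "HOL-Algebra.Lattice" "HOL-Library.Disjoint_Sets"
begin

text \<open>
  A semigroup is a carrier set \<open>S\<close> together with a binary operation \<open>m\<close> on the ambient type,
  of which only the restriction to \<open>S\<close> matters.  The carrier may be empty.
\<close>

locale semigroup_on =
  fixes S :: "'a set" and m :: "'a \<Rightarrow> 'a \<Rightarrow> 'a" (infixl "\<star>" 70)
  assumes closed: "\<lbrakk>x \<in> S; y \<in> S\<rbrakk> \<Longrightarrow> x \<star> y \<in> S"
    and assoc: "\<lbrakk>x \<in> S; y \<in> S; z \<in> S\<rbrakk> \<Longrightarrow> (x \<star> y) \<star> z = x \<star> (y \<star> z)"

definition inverse_of :: "'a set \<Rightarrow> ('a \<Rightarrow> 'a \<Rightarrow> 'a) \<Rightarrow> 'a \<Rightarrow> 'a \<Rightarrow> bool" where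
  "inverse_of S m s t \<longleftrightarrow> t \<in> S \<and> s = m (m s t) s \<and> t = m (m t s) t"

definition idems :: "'a set \<Rightarrow> ('a \<Rightarrow> 'a \<Rightarrow> 'a) \<Rightarrow> 'a set" where
  "idems S m = {e \<in> S. m e e = e}"

locale regular_semigroup = semigroup_on S m
  for S :: "'a set" and m :: "'a \<Rightarrow> 'a \<Rightarrow> 'a" (infixl "\<star>" 70) +
  assumes regular: "s \<in> S \<Longrightarrow> \<exists>t. inverse_of S m s t"

locale right_normal_band = semigroup_on B m
  for B :: "'a set" and m :: "'a \<Rightarrow> 'a \<Rightarrow> 'a" (infixl "\<star>" 70) +
  assumes idempotent: "e \<in> B \<Longrightarrow> e \<star> e = e"
    and right_normal: "\<lbrakk>e \<in> B; f \<in> B; g \<in> B\<rbrakk> \<Longrightarrow> e \<star> f \<star> g = f \<star> e \<star> g"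

locale right_generalized_inverse_semigroup =
  regular_semigroup S m + idempotents: right_normal_band "idems S m" m
  for S :: "'a set" and m :: "'a \<Rightarrow> 'a \<Rightarrow> 'a" (infixl "\<star>" 70)

locale inverse_semigroup = semigroup_on T n
  for T :: "'a set" and n :: "'a \<Rightarrow> 'a \<Rightarrow> 'a" (infixl "\<star>" 70) +
  assumes unique_inverse: "t \<in> T \<Longrightarrow> \<exists>!u. inverse_of T n t u"

definition inv_elt :: "'a set \<Rightarrow> ('a \<Rightarrow> 'a \<Rightarrow> 'a) \<Rightarrow> 'a \<Rightarrow> 'a" where
  "inv_elt T n t = (THE u. inverse_of T n t u)"

definition dom_idem :: "'a set \<Rightarrow> ('a \<Rightarrow> 'a \<Rightarrow> 'a) \<Rightarrow> 'a \<Rightarrow> 'a" where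
  "dom_idem T n t = n (inv_elt T n t) t"

text \<open>
  The semilattice \<open>E(T)\<close>, with the natural order \<open>e \<le> f \<longleftrightarrow> e = ef\<close> on idempotents.
\<close>

definition idem_semilattice :: "'a set \<Rightarrow> ('a \<Rightarrow> 'a \<Rightarrow> 'a) \<Rightarrow> 'a gorder" where
  "idem_semilattice T n = \<lparr>carrier = idems T n, eq = (=), le = (\<lambda>e f. e = n e f)\<rparr>"

lemma (in inverse_semigroup) idems_mult:
  assumes "e \<in> idems T n" "f \<in> idems T n"
  shows "e \<star> f \<in> idems T n"
proof -
  have e: "e \<in> T" "e \<star> e = e" and f: "f \<in> T" "f \<star> f = f"
    using assms by (auto simp: idems_def)
  have ee: "e \<star> (e \<star> z) = e \<star> z" if "z \<in> T" for z
    using assoc e that by metis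
  have ff: "f \<star> (f \<star> z) = f \<star> z" if "z \<in> T" for z
    using assoc f that by metis
  obtain x where x: "x \<in> T" "e \<star> f = e \<star> f \<star> x \<star> (e \<star> f)" "x = x \<star> (e \<star> f) \<star> x"
    using unique_inverse[OF closed[OF e(1) f(1)]] by (auto simp: inverse_of_def)
  have x2: "e \<star> (f \<star> (x \<star> (e \<star> f))) = e \<star> f" "x \<star> (e \<star> (f \<star> x)) = x"
    using x e f by (simp_all add: assoc closed)
  have x3: "x \<star> (e \<star> (f \<star> (x \<star> z))) = x \<star> z" if "z \<in> T" for z
    using x2(2) assoc closed x(1) e f that by metis
  let ?y = "f \<star> (x \<star> e)"
  have yT: "?y \<in> T" using x e f by (simp add: closed)
  have yy: "?y \<star> ?y = ?y" using x(1) e f by (simp add: assoc closed x3)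
  have inv1: "inverse_of T n (e \<star> f) ?y" "inverse_of T n ?y (e \<star> f)"
    using x(1) e f yT by (simp_all add: inverse_of_def assoc closed ee ff x2 x3)
  have inv2: "inverse_of T n ?y ?y" using yT yy by (simp add: inverse_of_def)
  have "e \<star> f = ?y" using inv1(2) inv2 unique_inverse[OF yT] by blast
  then show ?thesis using yy yT by (simp add: idems_def)
qed

lemma (in inverse_semigroup) idems_commute:
  assumes "e \<in> idems T n" "f \<in> idems T n"
  shows "e \<star> f = f \<star> e"
proof -
  have e: "e \<in> T" "e \<star> e = e" and f: "f \<in> T" "f \<star> f = f"
    using assms by (auto simp: idems_def)
  have ee: "e \<star> (e \<star> z) = e \<star> z" if "z \<in> T" for z
    using assoc e that by metis
  have ff: "f \<star> (f \<star> z) = f \<star> z" if "z \<in> T" for z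
    using assoc f that by metis
  have ef: "e \<star> f \<star> (e \<star> f) = e \<star> f" and fe: "f \<star> e \<star> (f \<star> e) = f \<star> e"
    using idems_mult assms by (auto simp: idems_def)
  have "inverse_of T n (e \<star> f) (f \<star> e)" "inverse_of T n (e \<star> f) (e \<star> f)"
    using e f ef fe by (simp_all add: inverse_of_def assoc closed ee ff)
  then show ?thesis using unique_inverse[OF closed[OF e(1) f(1)]] by blast
qed

text \<open>The order of \<open>E(T)\<close> is a meet semilattice whose meet is the product of \<open>T\<close>.\<close>

lemma (in inverse_semigroup) idem_semilattice_glb:
  assumes e: "e \<in> idems T n" and f: "f \<in> idems T n"
  shows "is_glb (idem_semilattice T n) (e \<star> f) {e, f}"
proof -
  have T: "x \<in> idems T n \<Longrightarrow> x \<in> T \<and> x \<star> x = x" for x by (simp add: idems_def)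
  show ?thesis
    using e f T idems_mult[OF e f] idems_commute[OF e f] T[OF e] T[OF f]
    unfolding greatest_def Lower_def idem_semilattice_def
    by auto (metis assoc closed)+
qed

lemma (in inverse_semigroup) lower_semilattice_idem_semilattice:
  "lower_semilattice (idem_semilattice T n)"
proof
  fix e f assume "e \<in> carrier (idem_semilattice T n)" "f \<in> carrier (idem_semilattice T n)"
  then show "\<exists>g. is_glb (idem_semilattice T n) g {e, f}"
    using idem_semilattice_glb by (auto simp: idem_semilattice_def)
next
  fix e f g
  assume "e \<sqsubseteq>\<^bsub>idem_semilattice T n\<^esub> f" "f \<sqsubseteq>\<^bsub>idem_semilattice T n\<^esub> g"
    "e \<in> carrier (idem_semilattice T n)" "f \<in> carrier (idem_semilattice T n)"
    "g \<in> carrier (idem_semilattice T n)"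
  then show "e \<sqsubseteq>\<^bsub>idem_semilattice T n\<^esub> g"
    by (auto simp: idem_semilattice_def idems_def) (metis assoc)
next
  fix e f
  assume "e \<sqsubseteq>\<^bsub>idem_semilattice T n\<^esub> f" "f \<sqsubseteq>\<^bsub>idem_semilattice T n\<^esub> e"
    "e \<in> carrier (idem_semilattice T n)" "f \<in> carrier (idem_semilattice T n)"
  then show "e .=\<^bsub>idem_semilattice T n\<^esub> f"
    using idems_commute by (auto simp: idem_semilattice_def)
qed (auto simp: idem_semilattice_def idems_def)

lemma (in inverse_semigroup) meet_idem_semilattice:
  assumes "e \<in> idems T n" "f \<in> idems T n"
  shows "e \<sqinter>\<^bsub>idem_semilattice T n\<^esub> f = e \<star> f"
proof -
  interpret E: lower_semilattice "idem_semilattice T n"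
    by (rule lower_semilattice_idem_semilattice)
  show ?thesis unfolding meet_def inf_def
    using idem_semilattice_glb[OF assms] E.greatest_unique by blast
qed

text \<open>
  Presheaves of sets over a meet semilattice \<open>E\<close>: \<open>X e\<close> is the fibre over \<open>e\<close>, and
  \<open>res e f x\<close> is the restriction of \<open>x \<in> X e\<close> to \<open>f\<close>, relevant only for \<open>f \<sqsubseteq> e\<close> in \<open>E\<close>.
\<close>

locale presheaf_of_sets = lower_semilattice E
  for E :: "('e, 'r) gorder_scheme" (structure)
    and X :: "'e \<Rightarrow> 'x set" and res :: "'e \<Rightarrow> 'e \<Rightarrow> 'x \<Rightarrow> 'x" +
  assumes disjoint_fibres: "disjoint_family_on X (carrier E)"
    and res_closed:
      "\<lbrakk>e \<in> carrier E; f \<in> carrier E; f \<sqsubseteq> e; x \<in> X e\<rbrakk> \<Longrightarrow> res e f x \<in> X f"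
    and res_id: "\<lbrakk>e \<in> carrier E; x \<in> X e\<rbrakk> \<Longrightarrow> res e e x = x"
    and res_comp:
      "\<lbrakk>e \<in> carrier E; f \<in> carrier E; g \<in> carrier E; f \<sqsubseteq> e; g \<sqsubseteq> f; x \<in> X e\<rbrakk>
        \<Longrightarrow> res f g (res e f x) = res e g x"

definition global_support :: "('e, 'r) gorder_scheme \<Rightarrow> ('e \<Rightarrow> 'x set) \<Rightarrow> bool" where
  "global_support E X \<longleftrightarrow> (\<forall>e\<in>carrier E. X e \<noteq> {})"

definition total_set :: "('e, 'r) gorder_scheme \<Rightarrow> ('e \<Rightarrow> 'x set) \<Rightarrow> 'x set" where
  "total_set E X = (\<Union>e\<in>carrier E. X e)"

definition proj :: "('e, 'r) gorder_scheme \<Rightarrow> ('e \<Rightarrow> 'x set) \<Rightarrow> 'x \<Rightarrow> 'e" where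
  "proj E X x = (THE e. e \<in> carrier E \<and> x \<in> X e)"

definition presheaf_act ::
    "('e, 'r) gorder_scheme \<Rightarrow> ('e \<Rightarrow> 'x set) \<Rightarrow> ('e \<Rightarrow> 'e \<Rightarrow> 'x \<Rightarrow> 'x) \<Rightarrow> 'e \<Rightarrow> 'x \<Rightarrow> 'x" where
  "presheaf_act E X res e x = res (proj E X x) (e \<sqinter>\<^bsub>E\<^esub> proj E X x) x"

definition yamada_carrier ::
    "'t set \<Rightarrow> ('t \<Rightarrow> 't \<Rightarrow> 't) \<Rightarrow> ('t \<Rightarrow> 'x set) \<Rightarrow> ('t \<times> 'x) set" where
  "yamada_carrier T n X =
    {(t, x). t \<in> T \<and> x \<in> total_set (idem_semilattice T n) X
      \<and> dom_idem T n t = proj (idem_semilattice T n) X x}"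

definition yamada_mult ::
    "'t set \<Rightarrow> ('t \<Rightarrow> 't \<Rightarrow> 't) \<Rightarrow> ('t \<Rightarrow> 'x set) \<Rightarrow> ('t \<Rightarrow> 't \<Rightarrow> 'x \<Rightarrow> 'x)
      \<Rightarrow> 't \<times> 'x \<Rightarrow> 't \<times> 'x \<Rightarrow> 't \<times> 'x" where
  "yamada_mult T n X res = (\<lambda>(s, x) (t, y).
    (n s t, presheaf_act (idem_semilattice T n) X res (dom_idem T n (n s t)) y))"

definition isomorphic_semigroups ::
    "'a set \<Rightarrow> ('a \<Rightarrow> 'a \<Rightarrow> 'a) \<Rightarrow> 'b set \<Rightarrow> ('b \<Rightarrow> 'b \<Rightarrow> 'b) \<Rightarrow> bool" where
  "isomorphic_semigroups S m S' m' \<longleftrightarrow>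
    (\<exists>h. bij_betw h S S' \<and> (\<forall>x\<in>S. \<forall>y\<in>S. h (m x y) = m' (h x) (h y)))"

end

theory Submission
  imports Defs
begin

text \<open>
  Let \<open>\<gamma>\<close> relate two elements of \<open>S\<close> when they have the same inverses; it is the least inverse
  congruence of \<open>S\<close>, and \<open>T = S/\<gamma>\<close>.  The idempotents of \<open>S\<close> form a presheaf over \<open>E(T)\<close>: the
  fibre over a class is the set of idempotents in that class, and restriction to a class is left
  multiplication by any idempotent \<open>f\<close> of that class, which by right normality does not depend on
  \<open>f\<close>.  Right normality also makes \<open>s's\<close> the same for all inverses \<open>s'\<close> of \<open>s\<close>, and the
  isomorphism sends \<open>s\<close> to the pair formed by its class and \<open>s's\<close>.
\<close>

section \<open>Inverses and inverse semigroups\<close>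

text \<open>Rewrite rules for right-associated products: the versions with a trailing
  \<open>z\<close> let the simplifier cancel inside a longer word.\<close>

lemma (in semigroup_on) inverse_simps:
  assumes "s \<in> S" "inverse_of S m s u"
  shows "u \<in> S"
    and "s \<star> (u \<star> s) = s" "\<And>z. z \<in> S \<Longrightarrow> s \<star> (u \<star> (s \<star> z)) = s \<star> z"
    and "u \<star> (s \<star> u) = u" "\<And>z. z \<in> S \<Longrightarrow> u \<star> (s \<star> (u \<star> z)) = u \<star> z"
proof -
  show u: "u \<in> S" using assms by (simp add: inverse_of_def)
  show 1: "s \<star> (u \<star> s) = s" and 2: "u \<star> (s \<star> u) = u"
    using assms u by (simp_all add: inverse_of_def assoc)
  show "s \<star> (u \<star> (s \<star> z)) = s \<star> z" if "z \<in> S" for z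
    using arg_cong[OF 1, of "\<lambda>y. y \<star> z"] assms(1) u that by (simp add: assoc closed)
  show "u \<star> (s \<star> (u \<star> z)) = u \<star> z" if "z \<in> S" for z
    using arg_cong[OF 2, of "\<lambda>y. y \<star> z"] assms(1) u that by (simp add: assoc closed)
qed

lemma (in semigroup_on) inverse_of_idems:
  assumes "s \<in> S" "inverse_of S m s u"
  shows "u \<star> s \<in> idems S m" "s \<star> u \<in> idems S m"
  using assms(1) inverse_simps[OF assms] by (simp_all add: idems_def assoc closed)

text \<open>Commuting idempotents force two inverses \<open>u\<close>, \<open>v\<close> of
  \<open>t\<close> to coincide, because both reduce to the product \<open>utv\<close>.\<close>

lemma inverse_semigroupI:
  assumes "regular_semigroup T n"
    and comm: "\<And>e f. \<lbrakk>e \<in> idems T n; f \<in> idems T n\<rbrakk> \<Longrightarrow> n e f = n f e"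
  shows "inverse_semigroup T n"
proof -
  interpret regular_semigroup T n by fact
  have "u = v" if t: "t \<in> T" and u: "inverse_of T n t u" and v: "inverse_of T n t v" for t u v
  proof -
    note inverse_simps = inverse_simps[OF t u] inverse_simps[OF t v]
    note idem = inverse_of_idems[OF t u] inverse_of_idems[OF t v]
    have "u = n u (n (n t v) (n t u))" using t inverse_simps by (simp add: assoc closed)
    also have "\<dots> = n u (n (n t u) (n t v))" using comm[OF idem(4) idem(2)] by simp
    also have "\<dots> = n u (n t v)" using t inverse_simps by (simp add: assoc closed)
    finally have 1: "u = n u (n t v)" .
    have "v = n (n (n v t) (n u t)) v" using t inverse_simps by (simp add: assoc closed)
    also have "\<dots> = n (n (n u t) (n v t)) v" using comm[OF idem(3) idem(1)] by simp
    also have "\<dots> = n u (n t v)" using t inverse_simps by (simp add: assoc closed)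
    finally show ?thesis using 1 by simp
  qed
  then show ?thesis using regular by unfold_locales blast
qed

lemma (in inverse_semigroup) inv_elt_eq: "\<lbrakk>t \<in> T; inverse_of T n t u\<rbrakk> \<Longrightarrow> inv_elt T n t = u"
  unfolding inv_elt_def using unique_inverse by blast

lemma proj_eq:
  assumes "disjoint_family_on X (carrier E)" "e \<in> carrier E" "x \<in> X e"
  shows "proj E X x = e"
  unfolding proj_def using assms by (intro the_equality) (auto simp: disjoint_family_on_def)

section \<open>Inverses under right normality\<close>

context right_generalized_inverse_semigroup
begin

abbreviation (input) idm ("\<E>") where "\<E> \<equiv> idems S m"

lemma idems_closed: "e \<in> \<E> \<Longrightarrow> e \<in> S"
  by (simp add: idems_def)

lemma inverse_ofD:
  assumes "inverse_of S m s u"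
  shows "u \<in> S" "s \<star> u \<star> s = s" "u \<star> s \<star> u = u"
  using assms by (auto simp: inverse_of_def)

lemma inverse_of_idem: "e \<in> \<E> \<Longrightarrow> inverse_of S m e e"
  by (simp add: inverse_of_def idems_def)

text \<open>Right normality turns \<open>eff\<close> into \<open>fef\<close>. So Green's relation L
  is trivial on idempotents, the form in which right normality is used in the next two
  lemmas.\<close>

lemma idems_L_related_eq:
  assumes "e \<in> \<E>" "f \<in> \<E>" "e \<star> f = e" "f \<star> e = f"
  shows "e = f"
proof -
  have "e = e \<star> f \<star> f" using assms by (simp add: idempotents.assoc idempotents.idempotent)
  also have "\<dots> = f \<star> e \<star> f" using assms by (intro idempotents.right_normal)
  also have "\<dots> = f" using assms by (simp add: idempotents.idempotent)
  finally show ?thesis .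
qed

text \<open>From \<open>sus = s\<close> and \<open>svs = s\<close>, the idempotents
  \<open>us\<close> and \<open>vs\<close> satisfy \<open>(us)(vs) = us\<close> and
  \<open>(vs)(us) = vs\<close>, so they are L-related.\<close>

lemma inverse_left_unique:
  assumes s: "s \<in> S" and u: "inverse_of S m s u" and v: "inverse_of S m s v"
  shows "u \<star> s = v \<star> s"
  using inverse_of_idems[OF s u] inverse_of_idems[OF s v] inverse_simps[OF s u] inverse_simps[OF s v] s
  by - (rule idems_L_related_eq, simp_all add: assoc closed)

text \<open>Here \<open>utu = u\<close> and \<open>usu = u\<close> make the idempotents
  \<open>su\<close> and \<open>tu\<close> L-related.\<close>

lemma common_inverse_right_eq:
  assumes s: "s \<in> S" and t: "t \<in> S" and u: "inverse_of S m s u" "inverse_of S m t u"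
  shows "s \<star> u = t \<star> u"
  using inverse_of_idems[OF s u(1)] inverse_of_idems[OF t u(2)]
    inverse_simps[OF s u(1)] inverse_simps[OF t u(2)] s t
  by - (rule idems_L_related_eq, simp_all add: assoc closed)

text \<open>Idempotents are closed under products, so \<open>(us)(tv)\<close> and
  \<open>(tv)(us)\<close> are idempotent. Inserting the first between \<open>s\<close> and
  \<open>t\<close>, or the second between \<open>v\<close> and \<open>u\<close>, and then squaring
  it gives the two identities.\<close>

lemma inverse_of_mult:
  assumes s: "s \<in> S" and t: "t \<in> S" and u: "inverse_of S m s u" and v: "inverse_of S m t v"
  shows "inverse_of S m (s \<star> t) (v \<star> u)"
proof -
  note U = inverse_simps[OF s u] and V = inverse_simps[OF t v]
  let ?e = "t \<star> v" and ?f = "u \<star> s"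
  have ef: "?e \<in> \<E>" "?f \<in> \<E>" using inverse_of_idems s t u v by auto
  have i1: "(?f \<star> ?e) \<star> (?f \<star> ?e) = ?f \<star> ?e"
    using idempotents.idempotent idempotents.closed ef by simp
  have i2: "(?e \<star> ?f) \<star> (?e \<star> ?f) = ?e \<star> ?f"
    using idempotents.idempotent idempotents.closed ef by simp
  have "s \<star> t = s \<star> (?f \<star> ?e) \<star> t" using s t U V by (simp add: assoc closed)
  also have "\<dots> = s \<star> ((?f \<star> ?e) \<star> (?f \<star> ?e)) \<star> t" by (simp only: i1)
  also have "\<dots> = (s \<star> ?f) \<star> ?e \<star> ?f \<star> (?e \<star> t)" using s t U(1) V(1) by (simp add: assoc closed)
  also have "\<dots> = s \<star> ?e \<star> ?f \<star> t" using s t U V by (simp add: assoc closed)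
  also have "\<dots> = s \<star> t \<star> (v \<star> u) \<star> (s \<star> t)" using s t U(1) V(1) by (simp add: assoc closed)
  finally have 1: "s \<star> t = s \<star> t \<star> (v \<star> u) \<star> (s \<star> t)" .
  have "v \<star> u = v \<star> (?e \<star> ?f) \<star> u" using s t U V by (simp add: assoc closed)
  also have "\<dots> = v \<star> ((?e \<star> ?f) \<star> (?e \<star> ?f)) \<star> u" by (simp only: i2)
  also have "\<dots> = (v \<star> ?e) \<star> ?f \<star> ?e \<star> (?f \<star> u)" using s t U(1) V(1) by (simp add: assoc closed)
  also have "\<dots> = v \<star> ?f \<star> ?e \<star> u" using s t U V by (simp add: assoc closed)
  also have "\<dots> = v \<star> u \<star> (s \<star> t) \<star> (v \<star> u)" using s t U(1) V(1) by (simp add: assoc closed)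
  finally show ?thesis using 1 U(1) V(1) by (simp add: inverse_of_def closed)
qed

text \<open>One shared inverse forces all inverses to be shared. The equalities
  \<open>su = tu\<close> and \<open>us = vs\<close> allow \<open>t\<close> to be written as
  \<open>sut\<close>, after which \<open>v\<close> meets \<open>s\<close> and can be
  absorbed.\<close>

lemma common_inverse_transfer:
  assumes s: "s \<in> S" and t: "t \<in> S" and u: "inverse_of S m s u" "inverse_of S m t u"
    and v: "inverse_of S m s v"
  shows "inverse_of S m t v"
proof -
  note U = inverse_simps[OF s u(1)] inverse_simps[OF t u(2)] and V = inverse_simps[OF s v]
  have su: "s \<star> u = t \<star> u" by (rule common_inverse_right_eq[OF s t u])
  have us: "u \<star> s = v \<star> s" by (rule inverse_left_unique[OF s u(1) v])
  have "s \<star> (u \<star> t) = (t \<star> u) \<star> t" using U(1) s t by (simp add: su[symmetric] assoc)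
  then have t_eq: "s \<star> (u \<star> t) = t" using U s t by (simp add: assoc)
  \<comment> \<open>Each of the idempotents \<open>us\<close> and \<open>ut\<close> is a left
    identity for the other; this collapses \<open>vtv\<close> and \<open>tvt\<close> below.\<close>
  have "(u \<star> t) \<star> (u \<star> s) = u \<star> (s \<star> u) \<star> s" using U(1) s t by (simp add: su assoc closed)
  then have ts: "(u \<star> t) \<star> (u \<star> s) = u \<star> s" using U s by (simp add: assoc closed)
  have st: "(u \<star> s) \<star> (u \<star> t) = u \<star> t" using U s t by (simp add: assoc closed)
  have usv: "(u \<star> s) \<star> v = v" using us V s by (simp add: assoc)
  have "v \<star> t \<star> v = v \<star> (s \<star> (u \<star> t)) \<star> v" by (simp only: t_eq)
  also have "\<dots> = (v \<star> s) \<star> (u \<star> t) \<star> v" using U(1) V(1) s t by (simp add: assoc closed)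
  also have "\<dots> = (u \<star> t) \<star> v" by (simp add: us[symmetric] st)
  also have "\<dots> = ((u \<star> t) \<star> (u \<star> s)) \<star> v" 
    using usv U(1) V(1) s t by (simp add: assoc closed)
  also have "\<dots> = v" by (simp add: ts usv)
  finally have 1: "v \<star> t \<star> v = v" .
  have "t \<star> v \<star> t = (s \<star> (u \<star> t)) \<star> v \<star> (s \<star> (u \<star> t))" by (simp only: t_eq)
  also have "\<dots> = s \<star> ((u \<star> t) \<star> (v \<star> s) \<star> (u \<star> t))"
    using U(1) V(1) s t by (simp add: assoc closed)
  also have "\<dots> = t" by (simp add: us[symmetric] ts st t_eq)
  finally show ?thesis using 1 V(1) by (simp add: inverse_of_def)
qed

section \<open>The congruence and its quotient\<close>

definition gamma_class :: "'a \<Rightarrow> 'a set" where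
  "gamma_class s = {t \<in> S. inverse_of S m t = inverse_of S m s}"

definition gamma_quotient :: "'a set set" where
  "gamma_quotient = gamma_class ` S"

text \<open>Multiplies chosen representatives; \<open>gamma_class_mult_cong\<close> shows that the
  choice does not affect the product of two classes.\<close>

definition gamma_mult :: "'a set \<Rightarrow> 'a set \<Rightarrow> 'a set" where
  "gamma_mult A B = gamma_class ((SOME a. a \<in> A) \<star> (SOME b. b \<in> B))"

lemma gamma_class_self: "s \<in> S \<Longrightarrow> s \<in> gamma_class s"
  by (simp add: gamma_class_def)

lemma gamma_class_eq: "t \<in> gamma_class s \<Longrightarrow> gamma_class t = gamma_class s"
  by (auto simp: gamma_class_def)

lemma gamma_class_eqI:
  assumes "s \<in> S" "t \<in> S" "inverse_of S m s u" "inverse_of S m t u"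
  shows "gamma_class s = gamma_class t"
proof -
  have "inverse_of S m s = inverse_of S m t"
    using common_inverse_transfer assms by blast
  then show ?thesis by (simp add: gamma_class_def)
qed

lemma gamma_class_eq_iff:
  assumes "s \<in> S"
  shows "gamma_class s = gamma_class t \<longleftrightarrow> inverse_of S m s = inverse_of S m t"
  using gamma_class_self[OF assms] by (auto simp: gamma_class_def)

text \<open>If \<open>u\<close> is shared by \<open>s\<close>, \<open>s'\<close> and
  \<open>v\<close> by \<open>t\<close>, \<open>t'\<close>, then \<open>vu\<close> is an inverse of
  both products, and one common inverse suffices.\<close>

lemma gamma_class_mult_cong:
  assumes "s \<in> S" "t \<in> S" "s' \<in> S" "t' \<in> S"
    and "gamma_class s = gamma_class s'" "gamma_class t = gamma_class t'"
  shows "gamma_class (s \<star> t) = gamma_class (s' \<star> t')"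
proof -
  obtain u v where u: "inverse_of S m s u" and v: "inverse_of S m t v"
    using assms regular by metis
  then have "inverse_of S m s' u" "inverse_of S m t' v"
    using assms by (simp_all add: gamma_class_eq_iff)
  then show ?thesis
    using u v assms by (intro gamma_class_eqI[of _ _ "v \<star> u"] inverse_of_mult closed)
qed

lemma gamma_mult_class:
  assumes "s \<in> S" "t \<in> S"
  shows "gamma_mult (gamma_class s) (gamma_class t) = gamma_class (s \<star> t)"
proof -
  have "(SOME a. a \<in> gamma_class s) \<in> gamma_class s" "(SOME b. b \<in> gamma_class t) \<in> gamma_class t"
    using assms[THEN gamma_class_self] by (auto simp: some_in_eq)
  then show ?thesis
    unfolding gamma_mult_def using assms gamma_class_eq
    by (intro gamma_class_mult_cong) (auto simp: gamma_class_def)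
qed

lemma inverse_of_gamma_class:
  assumes "s \<in> S" "inverse_of S m s u"
  shows "inverse_of gamma_quotient gamma_mult (gamma_class s) (gamma_class u)"
  using assms inverse_ofD[OF assms(2)]
  by (auto simp: inverse_of_def gamma_mult_class closed gamma_quotient_def)

text \<open>If \<open>a\<^sup>2 \<gamma> a\<close> then an inverse \<open>u\<close> of \<open>a\<close> is the product \<open>(ua)(au)\<close> of idempotents.\<close>

lemma idem_of_gamma_idem:
  assumes a: "a \<in> S" and eq: "gamma_class (a \<star> a) = gamma_class a"
  shows "a \<in> \<E>"
proof -
  obtain u where u: "inverse_of S m a u" using a regular by blast
  note U = inverse_ofD[OF u]
  have "inverse_of S m (a \<star> a) u"
    using u eq a by (simp add: gamma_class_eq_iff closed)
  then have "(u \<star> a) \<star> (a \<star> u) = u"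
    using a U(1) by (simp add: inverse_of_def assoc closed)
  then have uE: "u \<in> \<E>"
    using idempotents.closed[OF inverse_of_idems[OF a u]] by simp
  \<comment> \<open>The idempotent \<open>u\<close> is its own inverse, so \<open>a\<close> and
    \<open>u\<close> have the common inverse \<open>u\<close>. Hence
    \<open>a = aua = uua = ua\<close>.\<close>
  then have "a \<star> u = u \<star> u"
    using a u U(1) by (intro common_inverse_right_eq inverse_of_idem)
  then have "a = u \<star> a" using U uE by (simp add: idems_def)
  then show ?thesis using inverse_of_idems[OF a u] by simp
qed

section \<open>Idempotents of the quotient\<close>

lemma idems_gamma_quotient: "idems gamma_quotient gamma_mult = gamma_class ` \<E>"
proof
  show "idems gamma_quotient gamma_mult \<subseteq> gamma_class ` \<E>"
  proof
    fix A assume "A \<in> idems gamma_quotient gamma_mult"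
    then obtain a where "a \<in> S" "A = gamma_class a" "gamma_mult A A = A"
      by (auto simp: idems_def gamma_quotient_def)
    then show "A \<in> gamma_class ` \<E>"
      using idem_of_gamma_idem by (simp add: gamma_mult_class)
  qed
  show "gamma_class ` \<E> \<subseteq> idems gamma_quotient gamma_mult"
    by (auto simp: idems_def gamma_quotient_def gamma_mult_class)
qed

text \<open>As \<open>e\<close> is its own inverse, it is also an inverse of \<open>f\<close>; right
  normality then moves \<open>e\<close> to the front of \<open>fef\<close>.\<close>

lemma gamma_idem_mult:
  assumes e: "e \<in> \<E>" and f: "f \<in> \<E>" and eq: "gamma_class e = gamma_class f"
  shows "e \<star> f = f"
proof -
  have "inverse_of S m f e"
    using inverse_of_idem[OF e] eq idems_closed[OF e] by (simp add: gamma_class_eq_iff)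
  then have "f = f \<star> e \<star> f" by (simp add: inverse_of_def)
  also have "\<dots> = e \<star> f \<star> f" by (rule idempotents.right_normal[OF f e f])
  also have "\<dots> = e \<star> f" using e f by (simp add: assoc idems_def)
  finally show ?thesis by simp
qed

text \<open>This makes restriction well defined: \<open>ex = fex = efx = fx\<close>, where the
  middle step is right normality.\<close>

lemma gamma_idem_mult_cong:
  assumes "e \<in> \<E>" "f \<in> \<E>" "gamma_class e = gamma_class f" "x \<in> \<E>"
  shows "e \<star> x = f \<star> x"
proof -
  have "e \<star> x = f \<star> e \<star> x" using assms by (simp add: gamma_idem_mult)
  also have "\<dots> = e \<star> f \<star> x" using assms by (simp add: idempotents.right_normal)
  also have "\<dots> = f \<star> x" using assms by (simp add: gamma_idem_mult)
  finally show ?thesis .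
qed

text \<open>The idempotent \<open>ef\<close> is an inverse both of itself and of
  \<open>fe\<close>.\<close>

lemma gamma_class_idems_commute:
  assumes e: "e \<in> \<E>" and f: "f \<in> \<E>"
  shows "gamma_class (e \<star> f) = gamma_class (f \<star> e)"
proof -
  have ef: "e \<star> f \<in> \<E>" and fe: "f \<star> e \<in> \<E>" using e f by (simp_all add: idempotents.closed)
  have ee: "e \<star> (e \<star> z) = e \<star> z" if "z \<in> S" for z
    using e that assoc[of e e z] by (simp add: idems_def)
  have ff: "f \<star> (f \<star> z) = f \<star> z" if "z \<in> S" for z
    using f that assoc[of f f z] by (simp add: idems_def)
  have "inverse_of S m (f \<star> e) (e \<star> f)"
    using ef fe e f by (simp add: inverse_of_def idems_def assoc closed ee ff)
  with inverse_of_idem[OF ef] show ?thesis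
    using ef fe by (intro gamma_class_eqI) (auto simp: idems_closed)
qed

lemma inverse_semigroup_gamma_quotient: "inverse_semigroup gamma_quotient gamma_mult"
proof (rule inverse_semigroupI)
  show "regular_semigroup gamma_quotient gamma_mult"
  proof
    fix A assume "A \<in> gamma_quotient"
    then obtain s where s: "s \<in> S" "A = gamma_class s" by (auto simp: gamma_quotient_def)
    then show "\<exists>B. inverse_of gamma_quotient gamma_mult A B"
      using regular inverse_of_gamma_class by metis
  qed (auto simp: gamma_quotient_def gamma_mult_class closed assoc)
next
  fix A B assume "A \<in> idems gamma_quotient gamma_mult" "B \<in> idems gamma_quotient gamma_mult"
  then show "gamma_mult A B = gamma_mult B A"
    by (auto simp: idems_gamma_quotient gamma_mult_class idems_closed gamma_class_idems_commute)
qed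

sublocale Q: inverse_semigroup gamma_quotient gamma_mult
  by (rule inverse_semigroup_gamma_quotient)

section \<open>The presheaf of idempotents\<close>

abbreviation gamma_semilattice :: "'a set gorder" where
  "gamma_semilattice \<equiv> idem_semilattice gamma_quotient gamma_mult"

definition fibre :: "'a set \<Rightarrow> 'a set" where
  "fibre A = A \<inter> \<E>"

definition restrict_idem :: "'a set \<Rightarrow> 'a set \<Rightarrow> 'a \<Rightarrow> 'a" where
  "restrict_idem A B x = (SOME f. f \<in> fibre B) \<star> x"

lemma carrier_gamma_semilattice: "carrier gamma_semilattice = gamma_class ` \<E>"
  by (simp add: idem_semilattice_def idems_gamma_quotient)

lemma le_gamma_semilattice: "A \<sqsubseteq>\<^bsub>gamma_semilattice\<^esub> B \<longleftrightarrow> A = gamma_mult A B"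
  by (simp add: idem_semilattice_def)

lemma meet_gamma_semilattice:
  assumes "e \<in> \<E>" "f \<in> \<E>"
  shows "gamma_class e \<sqinter>\<^bsub>gamma_semilattice\<^esub> gamma_class f = gamma_class (e \<star> f)"
  using assms by (simp add: Q.meet_idem_semilattice idems_gamma_quotient gamma_mult_class idems_closed)

lemma fibre_self: "e \<in> \<E> \<Longrightarrow> e \<in> fibre (gamma_class e)"
  by (simp add: fibre_def gamma_class_self idems_closed)

lemma fibreD: "x \<in> fibre (gamma_class e) \<Longrightarrow> x \<in> \<E> \<and> gamma_class x = gamma_class e"
  using gamma_class_eq by (auto simp: fibre_def)

text \<open>Any idempotent of the target class can replace the chosen one, by
  \<open>gamma_idem_mult_cong\<close>.\<close>

lemma restrict_idem_eq:
  assumes "f \<in> \<E>" "x \<in> \<E>"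
  shows "restrict_idem A (gamma_class f) x = f \<star> x"
proof -
  have "(SOME f'. f' \<in> fibre (gamma_class f)) \<in> fibre (gamma_class f)"
    using fibre_self[OF assms(1)] by (rule someI)
  then show ?thesis
    unfolding restrict_idem_def using assms fibreD by (intro gamma_idem_mult_cong) auto
qed

lemma disjoint_fibres: "disjoint_family_on fibre (carrier gamma_semilattice)"
  unfolding disjoint_family_on_def carrier_gamma_semilattice
  using fibreD by blast

lemma presheaf_fibre: "presheaf_of_sets gamma_semilattice fibre restrict_idem"
proof -
  interpret E: lower_semilattice gamma_semilattice
    by (rule Q.lower_semilattice_idem_semilattice)
  show ?thesis
  proof
    show "disjoint_family_on fibre (carrier gamma_semilattice)" by (rule disjoint_fibres)
  next
    fix A B x
    assume "A \<in> carrier gamma_semilattice" "B \<in> carrier gamma_semilattice"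
      and le: "B \<sqsubseteq>\<^bsub>gamma_semilattice\<^esub> A" and x: "x \<in> fibre A"
    then obtain e f where e: "e \<in> \<E>" "A = gamma_class e" and f: "f \<in> \<E>" "B = gamma_class f"
      by (auto simp: carrier_gamma_semilattice)
    have xE: "x \<in> \<E>" "A = gamma_class x" using x e fibreD by auto
    \<comment> \<open>The order in the semilattice says that \<open>B\<close> is the product of
      \<open>B\<close> and \<open>A\<close>, represented by the restriction \<open>fx\<close>
      itself.\<close>
    have "B = gamma_class (f \<star> x)"
      using le f xE by (simp add: le_gamma_semilattice gamma_mult_class idems_closed)
    then show "restrict_idem A B x \<in> fibre B"
      using f xE by (metis restrict_idem_eq fibre_self idempotents.closed)
  next
    fix A x
    assume "A \<in> carrier gamma_semilattice" and x: "x \<in> fibre A"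
    then have "x \<in> \<E>" "A = gamma_class x"
      using fibreD by (auto simp: carrier_gamma_semilattice)
    then show "restrict_idem A A x = x" by (simp add: restrict_idem_eq idems_def)
  next
    fix A B C x
    assume "A \<in> carrier gamma_semilattice" "B \<in> carrier gamma_semilattice"
      "C \<in> carrier gamma_semilattice"
      and le: "C \<sqsubseteq>\<^bsub>gamma_semilattice\<^esub> B" and x: "x \<in> fibre A"
    then obtain f g where xE: "x \<in> \<E>" and f: "f \<in> \<E>" "B = gamma_class f"
      and g: "g \<in> \<E>" "C = gamma_class g"
      using fibreD by (auto simp: carrier_gamma_semilattice)
    \<comment> \<open>Composition of restrictions is left multiplication by \<open>gf\<close>, an
      idempotent in the same class as \<open>g\<close>.\<close>
    have "gamma_class g = gamma_class (g \<star> f)"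
      using le f g by (simp add: le_gamma_semilattice gamma_mult_class idems_closed)
    then have "g \<star> x = g \<star> f \<star> x"
      using f g xE by (intro gamma_idem_mult_cong) (simp_all add: idempotents.closed)
    then show "restrict_idem B C (restrict_idem A B x) = restrict_idem A C x"
      using f g xE by (simp add: restrict_idem_eq idempotents.closed idempotents.assoc)
  qed
qed

lemma global_support_fibre: "global_support gamma_semilattice fibre"
  using fibre_self by (auto simp: global_support_def carrier_gamma_semilattice)

lemma total_set_fibre: "total_set gamma_semilattice fibre = \<E>"
  using fibre_self fibreD by (auto simp: total_set_def carrier_gamma_semilattice)

lemma proj_fibre: "x \<in> \<E> \<Longrightarrow> proj gamma_semilattice fibre x = gamma_class x"
  by (rule proj_eq[OF disjoint_fibres]) (auto simp: carrier_gamma_semilattice fibre_self)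

text \<open>The meet is the class of \<open>ex\<close>, so the action multiplies \<open>x\<close> by
  \<open>ex\<close>, and \<open>exx = ex\<close>. Thus the abstract action becomes multiplication in
  \<open>S\<close>.\<close>

lemma presheaf_act_fibre:
  assumes "e \<in> \<E>" "x \<in> \<E>"
  shows "presheaf_act gamma_semilattice fibre restrict_idem (gamma_class e) x = e \<star> x"
  using assms by (simp add: presheaf_act_def proj_fibre meet_gamma_semilattice restrict_idem_eq
      idempotents.closed idempotents.assoc idempotents.idempotent)

section \<open>Sources of elements\<close>

definition source :: "'a \<Rightarrow> 'a" where
  "source s = (SOME u. inverse_of S m s u) \<star> s"

lemma source_eq: "\<lbrakk>s \<in> S; inverse_of S m s u\<rbrakk> \<Longrightarrow> source s = u \<star> s"
  unfolding source_def by (rule inverse_left_unique) (auto intro: someI)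

lemma source_idem: "s \<in> S \<Longrightarrow> source s \<in> \<E>"
  using regular[of s] source_eq[of s] inverse_of_idems(1)[of s] by auto

lemma mult_source: "s \<in> S \<Longrightarrow> s \<star> source s = s"
  using regular[of s] source_eq[of s] inverse_simps(2)[of s] by auto

text \<open>The source of \<open>st\<close> has the form \<open>wst\<close>, and \<open>t\<close>
  absorbs its own source on the right. This is what the second coordinate of the homomorphism law
  needs.\<close>

lemma source_mult:
  assumes "s \<in> S" "t \<in> S"
  shows "source (s \<star> t) \<star> source t = source (s \<star> t)"
proof -
  obtain w where w: "inverse_of S m (s \<star> t) w" using assms regular closed by blast
  have "source (s \<star> t) \<star> source t = w \<star> (s \<star> (t \<star> source t))"
    using assms w inverse_ofD(1)[OF w]
    by (simp add: source_eq[OF _ w] assoc closed idems_closed source_idem)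
  then show ?thesis using assms w by (simp add: mult_source source_eq[OF _ w] closed)
qed

text \<open>The quotient map sends inverses to inverses, and inverses in the quotient are
  unique.\<close>

lemma dom_idem_gamma_class:
  assumes "s \<in> S"
  shows "dom_idem gamma_quotient gamma_mult (gamma_class s) = gamma_class (source s)"
proof -
  obtain u where u: "inverse_of S m s u" using assms regular by blast
  have "inv_elt gamma_quotient gamma_mult (gamma_class s) = gamma_class u"
    using assms inverse_of_gamma_class[OF assms u]
    by (intro Q.inv_elt_eq) (auto simp: gamma_quotient_def)
  then show ?thesis
    using assms inverse_ofD(1)[OF u] by (simp add: dom_idem_def gamma_mult_class source_eq[OF _ u])
qed

lemma yamada_carrier_gamma:
  "yamada_carrier gamma_quotient gamma_mult fibre =
    {(gamma_class s, x) | s x. s \<in> S \<and> x \<in> \<E> \<and> gamma_class (source s) = gamma_class x}"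
proof -
  have "gamma_class s \<in> gamma_quotient" if "s \<in> S" for s
    using that by (simp add: gamma_quotient_def)
  moreover have "\<exists>s\<in>S. A = gamma_class s" if "A \<in> gamma_quotient" for A
    using that by (auto simp: gamma_quotient_def)
  ultimately show ?thesis
    unfolding yamada_carrier_def total_set_fibre
    by (fastforce simp: dom_idem_gamma_class proj_fibre)
qed

section \<open>The isomorphism\<close>

text \<open>Injectivity: with a common inverse \<open>u\<close>, equal sources give
  \<open>s = sut\<close>, and \<open>su = tu\<close> turns this into \<open>tut = t\<close>.\<close>

lemma eq_of_gamma_class_source:
  assumes s: "s \<in> S" and t: "t \<in> S"
    and eq: "gamma_class s = gamma_class t" "source s = source t"
  shows "s = t"
proof -
  obtain u where u: "inverse_of S m s u" using s regular by blast
  then have u': "inverse_of S m t u" using s eq(1) by (simp add: gamma_class_eq_iff)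
  have "s = s \<star> source s" using s by (simp add: mult_source)
  also have "\<dots> = s \<star> u \<star> t" using s t u u' inverse_ofD(1)[OF u] eq(2) by (simp add: source_eq assoc)
  also have "\<dots> = t \<star> u \<star> t" using common_inverse_right_eq[OF s t u u'] by simp
  also have "\<dots> = t" using inverse_ofD[OF u'] by simp
  finally show ?thesis .
qed

text \<open>Surjectivity: \<open>sx\<close> is the preimage of the pair of the class of
  \<open>s\<close> and \<open>x\<close>. It is congruent to \<open>s\<close> times its source, which
  is \<open>s\<close>; hence an inverse \<open>u\<close> of \<open>s\<close> also serves
  \<open>sx\<close>, and the source \<open>usx\<close> equals \<open>x\<close> since
  \<open>us\<close> and \<open>x\<close> are congruent idempotents.\<close>

lemma gamma_class_source_mult:
  assumes s: "s \<in> S" and x: "x \<in> \<E>" and eq: "gamma_class (source s) = gamma_class x"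
  shows "gamma_class (s \<star> x) = gamma_class s" "source (s \<star> x) = x"
proof -
  have xS: "x \<in> S" and d: "source s \<in> S" using x s by (auto simp: idems_closed source_idem)
  have "gamma_class (s \<star> x) = gamma_class (s \<star> source s)"
    using s xS d eq by (intro gamma_class_mult_cong) auto
  then show c: "gamma_class (s \<star> x) = gamma_class s" using s by (simp add: mult_source)
  obtain u where u: "inverse_of S m s u" using s regular by blast
  then have "inverse_of S m (s \<star> x) u"
    using c s xS by (simp add: gamma_class_eq_iff closed)
  then have "source (s \<star> x) = source s \<star> x"
    using s xS inverse_ofD(1)[OF u] u by (simp add: source_eq closed assoc)
  then show "source (s \<star> x) = x"
    using s x eq by (simp add: gamma_idem_mult source_idem)
qed

lemma isomorphic_yamada:
  "isomorphic_semigroups S m (yamada_carrier gamma_quotient gamma_mult fibre)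
    (yamada_mult gamma_quotient gamma_mult fibre restrict_idem)"
  unfolding isomorphic_semigroups_def
proof (intro exI conjI ballI)
  let ?h = "\<lambda>s. (gamma_class s, source s)"
  show "bij_betw ?h S (yamada_carrier gamma_quotient gamma_mult fibre)"
    unfolding bij_betw_def
  proof
    show "inj_on ?h S" using eq_of_gamma_class_source by (auto intro: inj_onI)
    show "?h ` S = yamada_carrier gamma_quotient gamma_mult fibre"
    proof
      show "?h ` S \<subseteq> yamada_carrier gamma_quotient gamma_mult fibre"
        using source_idem by (auto simp: yamada_carrier_gamma)
      show "yamada_carrier gamma_quotient gamma_mult fibre \<subseteq> ?h ` S"
      proof
        fix p assume "p \<in> yamada_carrier gamma_quotient gamma_mult fibre"
        then obtain s x where p: "p = (gamma_class s, x)" and s: "s \<in> S" and x: "x \<in> \<E>"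
          and eq: "gamma_class (source s) = gamma_class x"
          by (auto simp: yamada_carrier_gamma)
        have "p = ?h (s \<star> x)" using p gamma_class_source_mult[OF s x eq] by simp
        then show "p \<in> ?h ` S" using s x by (auto simp: closed idems_closed)
      qed
    qed
  qed
  fix s t assume s: "s \<in> S" and t: "t \<in> S"
  \<comment> \<open>In the second coordinate the action yields
    \<open>source (s \<star> t) \<star> source t\<close>, which \<open>source_mult\<close>
    simplifies.\<close>
  then show "?h (s \<star> t) = yamada_mult gamma_quotient gamma_mult fibre restrict_idem (?h s) (?h t)"
    by (simp add: yamada_mult_def gamma_mult_class dom_idem_gamma_class closed
        presheaf_act_fibre source_idem source_mult)
qed

end

theorem theorem4p4:
  fixes S :: "'a set" and m :: "'a \<Rightarrow> 'a \<Rightarrow> 'a"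
  assumes "right_generalized_inverse_semigroup S m"
  shows "\<exists>(T :: 'a set set) (n :: 'a set \<Rightarrow> 'a set \<Rightarrow> 'a set)
            (X :: 'a set \<Rightarrow> 'a set) (res :: 'a set \<Rightarrow> 'a set \<Rightarrow> 'a \<Rightarrow> 'a).
           inverse_semigroup T n \<and>
           presheaf_of_sets (idem_semilattice T n) X res \<and>
           global_support (idem_semilattice T n) X \<and>
           isomorphic_semigroups S m (yamada_carrier T n X) (yamada_mult T n X res)"
proof -
  interpret right_generalized_inverse_semigroup S m by fact
  show ?thesis
    using inverse_semigroup_gamma_quotient presheaf_fibre global_support_fibre isomorphic_yamada
    by blast
qed

end
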